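(* Let $m\ge 2$ and $N$ be integers, $N\geq 0$. The following are equivalent: (a) there exists a $3$-regular map of $S^m$ into $\mathbb{R}^N$; (b) there exists a $2$-regular map of $S^m$ into $\mathbb{R}^N$; (c) $N\ge m+2$.
   Context: All maps are continuous. A map $f:M\to\mathbb{R}^N$ from a smooth manifold $M$ is called $k$-regular ($k\ge 2$) if for any $k$ distinct points $x_1,\dots,x_k\in M$ the vectors $f(x_1),\dots,f(x_k)$ are linearly independent over $\mathbb{R}$. $S^m$ is the $m$-sphere. *)

theory Defs
  imports "HOL-Analysis.Analysis"
begin

text \<open>
  The target space is the library's \<open>Euclidean_space N\<close>, whose points are the sequences
  \<open>nat \<Rightarrow> real\<close> that vanish from index \<open>N\<close> on. Unlike \<open>real ^ 'n\<close> it includes the case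
  \<open>N = 0\<close> and allows \<open>N\<close> to be compared with other numbers. Correspondingly,
  \<open>nsphere m\<close> is the unit sphere in \<open>Euclidean_space (Suc m)\<close>, of dimension \<open>m\<close>.
\<close>

text \<open>
  Independence of a family (not of its set of values): a repeated vector makes it dependent.
\<close>

definition lin_indep_family :: "nat \<Rightarrow> (nat \<Rightarrow> nat \<Rightarrow> real) \<Rightarrow> bool" where
  "lin_indep_family k v \<longleftrightarrow>
     (\<forall>c :: nat \<Rightarrow> real. (\<forall>j. (\<Sum>i<k. c i * v i j) = 0) \<longrightarrow> (\<forall>i<k. c i = 0))"

text \<open>
  Only the topology of the manifold enters the notion, so the domain is an abstract topology.
\<close>

definition k_regular_map :: "nat \<Rightarrow> 'a topology \<Rightarrow> nat \<Rightarrow> ('a \<Rightarrow> nat \<Rightarrow> real) \<Rightarrow> bool" where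
  "k_regular_map k M N f \<longleftrightarrow>
     continuous_map M (Euclidean_space N) f \<and>
     (\<forall>x :: nat \<Rightarrow> 'a. (\<forall>i<k. x i \<in> topspace M) \<and> inj_on x {..<k}
        \<longrightarrow> lin_indep_family k (\<lambda>i. f (x i)))"

end

theory Submission
  imports Defs "HOL-Homology.Invariance_of_Domain"
begin

text \<open>
  Sufficiency of \<open>N \<ge> m + 2\<close>: three distinct points of a sphere are never collinear, so
  \<open>x \<mapsto> (1, x)\<close> is 3-regular.

  Necessity: if \<open>N \<le> m + 1\<close>, a 2-regular \<open>f\<close> on the sphere extends radially to a continuous
  injection of \<open>\<real>\<^sup>m\<^sup>+\<^sup>1\<close> into itself that fixes 0. By invariance of domain its image contains
  a neighbourhood of 0, hence a small negative multiple of some value \<open>f u\<close>. This multiple is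
  also a nonnegative multiple of a value \<open>f v\<close>, against 2-regularity.
\<close>

section \<open>Changing the target dimension and the number of points\<close>

lemma k_regular_map_mono_codomain:
  assumes "k_regular_map k M N f" "N \<le> N'"
  shows "k_regular_map k M N' f"
  using assms
  by (auto simp: k_regular_map_def Euclidean_space_def continuous_map_in_subtopology Pi_iff)

text \<open>An infinite space has room to complete the \<open>k\<close> points to \<open>l\<close>
  distinct ones, and a relation among the \<open>k\<close> values extends by zero coefficients. On a
  space with fewer than \<open>l\<close> points, \<open>l\<close>-regularity would say nothing
  beyond continuity.\<close>

lemma k_regular_map_antimono:
  assumes f: "k_regular_map l M N f" and "k \<le> l" and inf: "infinite (topspace M)"
  shows "k_regular_map k M N f"
  unfolding k_regular_map_def lin_indep_family_def
proof (intro conjI allI impI)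
  show "continuous_map M (Euclidean_space N) f"
    using f by (simp add: k_regular_map_def)
next
  fix x :: "nat \<Rightarrow> 'a" and c :: "nat \<Rightarrow> real" and i
  assume x: "(\<forall>i<k. x i \<in> topspace M) \<and> inj_on x {..<k}"
    and c: "\<forall>j. (\<Sum>i<k. c i * f (x i) j) = 0" and "i < k"
  have "infinite (topspace M - x ` {..<k})"
    using inf by (simp add: Diff_infinite_finite)
  then obtain e :: "nat \<Rightarrow> 'a" where e: "inj e" "range e \<subseteq> topspace M - x ` {..<k}"
    using infinite_countable_subset by metis
  define y where "y = (\<lambda>i. if i < k then x i else e i)"
  define d where "d = (\<lambda>i. if i < k then c i else 0)"
  have "inj_on y {..<l}"
    using x e unfolding y_def inj_on_def by (auto simp: image_subset_iff) (metis imageI lessThan_iff)+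
  moreover have "\<forall>i<l. y i \<in> topspace M"
    using x e by (auto simp: y_def)
  ultimately have "lin_indep_family l (\<lambda>i. f (y i))"
    using f by (auto simp: k_regular_map_def)
  moreover have "(\<Sum>i<l. d i * f (y i) j) = 0" for j
  proof -
    have "(\<Sum>i<l. d i * f (y i) j) = (\<Sum>i<k. d i * f (y i) j)"
      using \<open>k \<le> l\<close> by (intro sum.mono_neutral_right) (auto simp: d_def)
    then show ?thesis
      using c by (simp add: d_def y_def)
  qed
  ultimately have "\<forall>i<l. d i = 0"
    unfolding lin_indep_family_def by blast
  then show "c i = 0"
    using \<open>i < k\<close> \<open>k \<le> l\<close> by (metis d_def order_less_le_trans)
qed

lemma infinite_topspace_nsphere:
  assumes "m \<ge> 1"
  shows "infinite (topspace (nsphere m))"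
proof
  assume fin: "finite (topspace (nsphere m))"
  \<comment> \<open>A quarter of the unit circle in the first two coordinates, parametrised
    injectively by its first coordinate.\<close>
  define g :: "real \<Rightarrow> nat \<Rightarrow> real"
    where "g = (\<lambda>a i. if i = 0 then a else if i = 1 then sqrt (1 - a\<^sup>2) else 0)"
  have "g a \<in> topspace (nsphere m)" if "a \<in> {0..1}" for a
  proof -
    have "(\<Sum>i\<le>m. (g a i)\<^sup>2) = (\<Sum>i\<in>{0,1}. (g a i)\<^sup>2)"
      using assms by (intro sum.mono_neutral_right) (auto simp: g_def)
    also have "\<dots> = 1"
      using that by (simp add: g_def power_le_one)
    finally show ?thesis
      using assms by (auto simp: nsphere g_def)
  qed
  then have "g ` {0..1} \<subseteq> topspace (nsphere m)"
    by blast
  then have "finite (g ` {0..1})"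
    using fin finite_subset by blast
  moreover have "inj_on g {0..1}"
    by (rule inj_onI) (auto simp: g_def fun_eq_iff split: if_splits)
  ultimately have "finite {0..1::real}"
    using finite_imageD by blast
  then show False
    by (simp add: infinite_Icc)
qed

section \<open>A 3-regular map into dimension \<open>m + 2\<close>\<close>

text \<open>A linear relation among the vectors \<open>(1, x i)\<close> is an affine relation among
  the \<open>x i\<close>. On the unit sphere it becomes a relation among squared distances, where
  positivity forces contradictory signs on nonzero coefficients.\<close>

lemma lin_indep_cone_over_three_sphere_points:
  assumes x: "\<And>i. i < 3 \<Longrightarrow> x i \<in> topspace (nsphere m)" and inj: "inj_on x {..<3}"
  shows "lin_indep_family 3 (\<lambda>i. case_nat 1 (x i))"
  unfolding lin_indep_family_def
proof (intro allI impI)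
  fix c :: "nat \<Rightarrow> real" and i :: nat
  assume "\<forall>j. (\<Sum>i<3. c i * (case j of 0 \<Rightarrow> 1 | Suc n \<Rightarrow> x i n)) = 0" and "i < 3"
  then have rel: "(\<Sum>i<3. c i * (case j of 0 \<Rightarrow> 1 | Suc n \<Rightarrow> x i n)) = 0" for j
    by blast
  have c0: "(\<Sum>i<3. c i) = 0"
    using rel[of 0] by simp
  have cx: "(\<Sum>i<3. c i * x i n) = 0" for n
    using rel[of "Suc n"] by simp
  \<comment> \<open>The squared distance. Between unit vectors it is 2 minus twice the inner
    product, so \<open>c0\<close> and \<open>cx\<close> together annihilate it in
    \<open>D_rel\<close>.\<close>
  define D where "D = (\<lambda>i k. \<Sum>n\<le>m. (x i n - x k n)\<^sup>2)"
  have unit: "(\<Sum>n\<le>m. (x i n)\<^sup>2) = 1" if "i < 3" for i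
    using x[OF that] by (simp add: nsphere)
  have D_eq: "D i k = 2 - 2 * (\<Sum>n\<le>m. x i n * x k n)" if "i < 3" "k < 3" for i k
    using unit[OF that(1)] unit[OF that(2)]
    by (simp add: D_def power2_diff sum.distrib sum_subtractf sum_distrib_left mult.assoc)
  have D_pos: "D i k > 0" if "i < 3" "k < 3" "i \<noteq> k" for i k
  proof -
    have "x i \<noteq> x k"
      using inj that by (auto simp: inj_on_def)
    then obtain n where n: "x i n \<noteq> x k n"
      by blast
    then have "n \<le> m"
      using x[OF that(1)] x[OF that(2)] by (auto simp: nsphere) (metis not_le)
    then show ?thesis
      unfolding D_def using n by (intro sum_pos2[of _ n]) auto
  qed
  have D_rel: "(\<Sum>i<3. c i * D i k) = 0" if "k < 3" for k
  proof -
    have "(\<Sum>i<3. c i * (\<Sum>n\<le>m. x i n * x k n)) = (\<Sum>i<3. \<Sum>n\<le>m. c i * x i n * x k n)"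
      by (simp add: sum_distrib_left mult.assoc)
    also have "\<dots> = (\<Sum>n\<le>m. \<Sum>i<3. c i * x i n * x k n)"
      by (rule sum.swap)
    also have "\<dots> = 0"
      using cx by (simp flip: sum_distrib_right)
    finally have *: "(\<Sum>i<3. c i * (\<Sum>n\<le>m. x i n * x k n)) = 0" .
    have "(\<Sum>i<3. c i * D i k) = (\<Sum>i<3. 2 * c i - 2 * (c i * (\<Sum>n\<le>m. x i n * x k n)))"
      using that by (intro sum.cong) (auto simp: D_eq algebra_simps)
    also have "\<dots> = 2 * (\<Sum>i<3. c i) - 2 * (\<Sum>i<3. c i * (\<Sum>n\<le>m. x i n * x k n))"
      by (simp only: sum_subtractf sum_distrib_left)
    finally show ?thesis
      using c0 * by simp
  qed
  have D_sym: "D i k = D k i" for i k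
    by (simp add: D_def power2_commute)
  have D_self: "D i i = 0" for i
    by (simp add: D_def)
  text \<open>By \<open>D_rel\<close> any two of the three coefficients have opposite signs.\<close>
  have opp: "a = 0 \<and> b = 0 \<or> a * b < 0" if "a * p + b * q = 0" "p > 0" "q > 0" for a b p q :: real
  proof -
    have "b = - (p / q) * a"
      using that by (simp add: field_simps)
    moreover have "p / q > 0"
      using that by simp
    ultimately show ?thesis
      by (smt (verit) mult_minus_left mult_neg_pos mult_pos_pos mult_neg_neg mult_eq_0_iff)
  qed
  have 1: "c 1 * D 1 0 + c 2 * D 2 0 = 0"
    using D_rel[of 0] by (simp add: eval_nat_numeral D_self)
  have 2: "c 0 * D 1 0 + c 2 * D 2 1 = 0"
    using D_rel[of 1] by (simp add: eval_nat_numeral D_self D_sym)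
  have 3: "c 0 * D 2 0 + c 1 * D 2 1 = 0"
    using D_rel[of 2] by (simp add: eval_nat_numeral D_self D_sym)
  \<comment> \<open>Three nonzero reals cannot have pairwise opposite signs, since two of them share
    a sign.\<close>
  have "c 0 = 0 \<and> c 1 = 0 \<and> c 2 = 0"
    using opp[OF 1 D_pos D_pos] opp[OF 2 D_pos D_pos] opp[OF 3 D_pos D_pos]
    by (simp add: mult_less_0_iff) linarith
  moreover have "i = 0 \<or> i = 1 \<or> i = 2"
    using \<open>i < 3\<close> by linarith
  ultimately show "c i = 0"
    by auto
qed

text \<open>\<open>case_nat 1\<close> puts the coordinate 1 in front and shifts the others by one
  place, so a point vanishing beyond index \<open>m\<close> goes to one vanishing from index
  \<open>m + 2\<close> on.\<close>

lemma k_regular_map_3_nsphere: "k_regular_map 3 (nsphere m) (m + 2) (case_nat 1)"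
  unfolding k_regular_map_def
proof (intro conjI allI impI)
  have "continuous_map (nsphere m) euclideanreal (\<lambda>x. case i of 0 \<Rightarrow> 1 | Suc n \<Rightarrow> x n)" for i
    by (cases i) (auto simp: continuous_map_nsphere_projection)
  then show "continuous_map (nsphere m) (Euclidean_space (m + 2)) (case_nat 1)"
    unfolding Euclidean_space_def continuous_map_in_subtopology
    by (auto simp: continuous_map_componentwise_UNIV nsphere split: nat.splits)
qed (use lin_indep_cone_over_three_sphere_points in blast)

section \<open>The radial extension and the lower bound on the dimension\<close>

lemma k_regular_map_2D:
  assumes "k_regular_map 2 M N f" "u \<in> topspace M" "v \<in> topspace M" "u \<noteq> v"
    and "\<And>j. a * f u j + b * f v j = 0"
  shows "a = 0" "b = 0"
proof -
  define x where "x = case_nat u (\<lambda>_. v)"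
  have "\<forall>i<2. x i \<in> topspace M" "inj_on x {..<2}"
    using assms by (auto simp: x_def inj_on_def less_2_cases_iff)
  then have "lin_indep_family 2 (\<lambda>i. f (x i))"
    using assms(1) unfolding k_regular_map_def by blast
  moreover have "\<forall>j. (\<Sum>i<2. case_nat a (\<lambda>_. b) i * f (x i) j) = 0"
    using assms(5) by (simp add: eval_nat_numeral x_def)
  ultimately have *: "\<forall>i<2. case_nat a (\<lambda>_. b) i = 0"
    unfolding lin_indep_family_def by blast
  then show "a = 0" "b = 0"
    using *[rule_format, of 0] *[rule_format, of 1] by auto
qed

text \<open>A closed subset of a product of intervals, which is compact by Tychonoff. Compactness
  later bounds \<open>f\<close> near the origin of the radial extension.\<close>

lemma compact_space_nsphere: "compact_space (nsphere m)"
proof -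
  let ?S = "{x. (\<Sum>i\<le>m. (x i)\<^sup>2) = (1::real) \<and> (\<forall>i>m. x i = 0)}"
  have "compactin (powertop_real UNIV) (Pi\<^sub>E UNIV (\<lambda>_. {-1..1}))"
    by (simp add: compactin_PiE)
  moreover have "?S \<subseteq> Pi\<^sub>E UNIV (\<lambda>_. {-1..1})"
  proof clarify
    fix x :: "nat \<Rightarrow> real"
    assume x: "(\<Sum>i\<le>m. (x i)\<^sup>2) = 1" "\<forall>i>m. x i = 0"
    have "\<bar>x i\<bar> \<le> 1" for i
    proof (cases "i \<le> m")
      case True
      then have "(x i)\<^sup>2 \<le> 1"
        using member_le_sum[of i "{..m}" "\<lambda>i. (x i)\<^sup>2"] x by simp
      then show ?thesis
        by (simp add: abs_square_le_1)
    qed (use x in simp)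
    then show "x \<in> Pi\<^sub>E UNIV (\<lambda>_. {-1..1})"
      by (auto simp: PiE_def Pi_iff abs_le_iff minus_le_iff)
  qed
  moreover have "closed ?S"
    by (intro closed_Collect_conj closed_Collect_all closed_Collect_imp closed_Collect_eq
        continuous_intros) auto
  ultimately have "compactin (powertop_real UNIV) ?S"
    by (intro closed_compactin[of _ _ ?S]) (simp_all add: euclidean_product_topology)
  then show ?thesis
    unfolding nsphere by (rule compact_space_subtopology)
qed

text \<open>At the origin the radial extension has the correct value 0, although \<open>f\<close> is evaluated there
  at the junk point \<open>\<lambda>j. x j / 0\<close>.\<close>

lemma continuous_map_radial_extension:
  assumes f: "continuous_map (nsphere m) (Euclidean_space n) f"
  defines "r \<equiv> \<lambda>x::nat \<Rightarrow> real. sqrt (\<Sum>i\<le>m. (x i)\<^sup>2)"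
  shows "continuous_map (Euclidean_space (Suc m)) (Euclidean_space n)
           (\<lambda>x i. r x * f (\<lambda>j. x j / r x) i)"
proof -
  let ?E = "Euclidean_space (Suc m)"
  let ?T = "topspace ?E"
  let ?F = "\<lambda>x i. r x * f (\<lambda>j. x j / r x) i"
  have r0: "r x = 0 \<longleftrightarrow> x = (\<lambda>_. 0)" if "x \<in> ?T" for x
  proof
    assume "r x = 0"
    then have "\<forall>i\<le>m. x i = 0"
      by (simp add: r_def sum_nonneg_eq_0_iff)
    then show "x = (\<lambda>_. 0)"
      using that by (auto simp: topspace_Euclidean_space fun_eq_iff) (metis not_less_eq_eq)
  qed (simp add: r_def)
  have r_nn: "r x \<ge> 0" for x
    by (simp add: r_def sum_nonneg)
  have sph: "(\<lambda>j. x j / r x) \<in> topspace (nsphere m)" if "x \<in> ?T" "r x \<noteq> 0" for x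
  proof -
    have "(\<Sum>j\<le>m. (x j / r x)\<^sup>2) = (\<Sum>j\<le>m. (x j)\<^sup>2) / (r x)\<^sup>2"
      by (simp add: power_divide sum_divide_distrib)
    also have "(\<Sum>j\<le>m. (x j)\<^sup>2) = (r x)\<^sup>2"
      by (simp add: r_def sum_nonneg)
    finally show ?thesis
      using that by (auto simp: nsphere topspace_Euclidean_space)
  qed
  have f_in: "f u \<in> topspace (Euclidean_space n)" if "u \<in> topspace (nsphere m)" for u
    using f that by (auto simp: continuous_map_def)
  have fi: "continuous_map (nsphere m) euclideanreal (\<lambda>u. f u i)" for i
    using f by (auto simp: Euclidean_space_def continuous_map_in_subtopology
        continuous_map_componentwise_UNIV)
  have fi_on: "continuous_on (topspace (nsphere m)) (\<lambda>u. f u i)" for i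
    using fi[of i] by (simp add: nsphere euclidean_product_topology)
  have r_cont: "continuous_on UNIV r"
    unfolding r_def by (intro continuous_intros continuous_on_product_coordinates)
  have Fi: "continuous_on ?T (\<lambda>x. ?F x i)" for i
    unfolding continuous_on_def
  proof
    fix x assume x: "x \<in> ?T"
    show "((\<lambda>x. ?F x i) \<longlongrightarrow> ?F x i) (at x within ?T)"
    proof (cases "r x = 0")
      case True
      \<comment> \<open>At the origin the extension is squeezed to 0 by \<open>r y * C\<close>,
        where \<open>C\<close> bounds the coordinate \<open>f u i\<close> over the compact
        sphere.\<close>
      have "compactin euclideanreal ((\<lambda>u. f u i) ` topspace (nsphere m))"
        using fi image_compactin compact_space_nsphere compact_space_def by metis
      then have "bounded ((\<lambda>u. f u i) ` topspace (nsphere m))"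
        by (simp add: compact_imp_bounded)
      then obtain C where C: "\<And>u. u \<in> topspace (nsphere m) \<Longrightarrow> \<bar>f u i\<bar> \<le> C"
        by (auto simp: bounded_iff)
      have "(r \<longlongrightarrow> r x) (at x within ?T)"
        using r_cont by (meson continuous_on_def continuous_on_subset subset_UNIV x)
      then have "((\<lambda>y. r y * C) \<longlongrightarrow> 0) (at x within ?T)"
        using True tendsto_mult_left_zero by fastforce
      moreover have "norm (?F y i) \<le> r y * C" if "y \<in> ?T" for y
        using C[OF sph[OF that]] r_nn[of y] by (cases "r y = 0") (auto simp: abs_mult mult_left_mono)
      then have "\<forall>\<^sub>F y in at x within ?T. norm (?F y i) \<le> r y * C"
        by (simp add: eventually_at_filter)
      ultimately have "((\<lambda>y. ?F y i) \<longlongrightarrow> 0) (at x within ?T)"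
        by (rule Lim_null_comparison[rotated])
      then show ?thesis
        using True by simp
    next
      case False
      \<comment> \<open>Away from the origin the defining formula is continuous, and openness of
        this set makes the restricted limit the limit within \<open>?T\<close>.\<close>
      have op: "open {y. r y \<noteq> 0}"
        using open_Collect_neq[OF r_cont continuous_on_const] .
      have "continuous_on (?T \<inter> {y. r y \<noteq> 0}) (\<lambda>y j. y j / r y)"
        by (intro continuous_on_coordinatewise_then_product continuous_intros
            continuous_on_subset[OF r_cont]
            continuous_on_subset[OF continuous_on_product_coordinates]) auto
      then have "continuous_on (?T \<inter> {y. r y \<noteq> 0}) (\<lambda>y. f (\<lambda>j. y j / r y) i)"
        by (rule continuous_on_compose2[OF fi_on]) (use sph in auto)
      then have "continuous_on (?T \<inter> {y. r y \<noteq> 0}) (\<lambda>y. ?F y i)"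
        by (intro continuous_intros continuous_on_subset[OF r_cont]) auto
      then have "((\<lambda>y. ?F y i) \<longlongrightarrow> ?F x i) (at x within ?T \<inter> {y. r y \<noteq> 0})"
        using x False by (auto simp: continuous_on_def)
      then show ?thesis
        using at_within_nhd[of x "{y. r y \<noteq> 0}" "?T \<inter> {y. r y \<noteq> 0}" ?T] False op by auto
    qed
  qed
  have "?F \<in> ?T \<rightarrow> topspace (Euclidean_space n)"
  proof
    fix x assume "x \<in> ?T"
    then show "?F x \<in> topspace (Euclidean_space n)"
      using f_in[OF sph] by (cases "r x = 0") (auto simp: topspace_Euclidean_space)
  qed
  with Fi show ?thesis
    by (auto simp: Euclidean_space_def continuous_map_in_subtopology
        euclidean_product_topology intro: continuous_on_coordinatewise_then_product)
qed

lemma k_regular_map_2_nsphere_dim: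
  assumes "k_regular_map 2 (nsphere m) N f"
  shows "N \<ge> m + 2"
proof (rule ccontr)
  assume "\<not> N \<ge> m + 2"
  \<comment> \<open>Invariance of domain needs equal dimensions, so the target is enlarged to
    exactly \<open>Suc m\<close>.\<close>
  then have f: "k_regular_map 2 (nsphere m) (Suc m) f"
    using k_regular_map_mono_codomain[OF assms] by simp
  let ?E = "Euclidean_space (Suc m)"
  let ?S = "topspace (nsphere m)"
  define r where "r = (\<lambda>x::nat \<Rightarrow> real. sqrt (\<Sum>i\<le>m. (x i)\<^sup>2))"
  define F where "F = (\<lambda>x i. r x * f (\<lambda>j. x j / r x) i)"
  have cont: "continuous_map ?E ?E F"
    using continuous_map_radial_extension[of m "Suc m" f] f
    by (simp add: F_def r_def k_regular_map_def)
  \<comment> \<open>2-regularity speaks of two distinct points, so \<open>u\<close> is paired with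
    its antipode, which gets coefficient 0.\<close>
  have nz: "a = 0" if u: "u \<in> ?S" and a: "\<And>j. a * f u j = 0" for u a
  proof -
    define v where "v = (\<lambda>j. - u j)"
    have "u \<noteq> (\<lambda>_. 0)"
      using u by (auto simp: nsphere)
    then have v: "v \<in> ?S" "u \<noteq> v"
      using u by (auto simp: v_def nsphere fun_eq_iff)
    show ?thesis
      using k_regular_map_2D(1)[OF f u v, of a 0] a by simp
  qed
  \<comment> \<open>Polar coordinates, with the origin included as \<open>t = 0\<close> and an
    arbitrary direction.\<close>
  have polar: "\<exists>u\<in>?S. \<exists>t\<ge>0. x = (\<lambda>i. t * u i) \<and> F x = (\<lambda>i. t * f u i)"
    if x: "x \<in> topspace ?E" for x
  proof (cases "r x = 0")
    case True
    then have "\<forall>i\<le>m. x i = 0"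
      by (simp add: r_def sum_nonneg_eq_0_iff)
    then have "x = (\<lambda>i. 0)"
      using x by (auto simp: topspace_Euclidean_space fun_eq_iff) (metis not_less_eq_eq)
    then show ?thesis
      using in_topspace_nsphere[of m] True by (force simp: F_def)
  next
    case False
    have "(\<Sum>j\<le>m. (x j / r x)\<^sup>2) = (\<Sum>j\<le>m. (x j)\<^sup>2) / (r x)\<^sup>2"
      by (simp add: power_divide sum_divide_distrib)
    also have "(\<Sum>j\<le>m. (x j)\<^sup>2) = (r x)\<^sup>2"
      by (simp add: r_def sum_nonneg)
    finally have "(\<lambda>j. x j / r x) \<in> ?S"
      using x False by (auto simp: nsphere topspace_Euclidean_space)
    moreover have "r x \<ge> 0"
      by (simp add: r_def sum_nonneg)
    ultimately show ?thesis
      using False by (intro bexI[of _ "\<lambda>j. x j / r x"] exI[of _ "r x"]) (auto simp: F_def)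
  qed
  \<comment> \<open>For equal directions \<open>nz\<close> gives equal radii; for different ones
    2-regularity makes both radii 0.\<close>
  have "inj_on F (topspace ?E)"
  proof (rule inj_onI)
    fix x y assume x: "x \<in> topspace ?E" and y: "y \<in> topspace ?E" and eq: "F x = F y"
    obtain u s where u: "u \<in> ?S" and s: "x = (\<lambda>i. s * u i)" "F x = (\<lambda>i. s * f u i)"
      using polar[OF x] by blast
    obtain v t where v: "v \<in> ?S" and t: "y = (\<lambda>i. t * v i)" "F y = (\<lambda>i. t * f v i)"
      using polar[OF y] by blast
    have rel: "s * f u j = t * f v j" for j
      using eq s t by (metis (no_types))
    show "x = y"
    proof (cases "u = v")
      case True
      have "(s - t) * f u j = 0" for j
        using rel[of j] True by (simp add: algebra_simps)
      then have "s - t = 0"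
        using nz[OF u] by blast
      then show ?thesis
        using s t True by simp
    next
      case False
      then show ?thesis
        using k_regular_map_2D[OF f u v False, of s "- t"] rel s t by simp
    qed
  qed
  then have op: "openin ?E (F ` topspace ?E)"
    using invariance_of_domain_Euclidean_space[of "Suc m" "topspace ?E" F] cont by simp
  obtain u where u: "u \<in> ?S"
    using in_topspace_nsphere by blast
  have "f u \<in> topspace ?E"
    using f u by (auto simp: k_regular_map_def continuous_map_def)
  \<comment> \<open>Pulling the open image of \<open>F\<close> back along the line through
    \<open>f u\<close> gives an open set of reals around 0, which contains negative numbers.\<close>
  then have "continuous_map euclideanreal ?E (\<lambda>t i. t * f u i)"
    by (auto simp: Euclidean_space_def continuous_map_in_subtopology
        continuous_map_componentwise_UNIV intro!: continuous_intros)
  from openin_continuous_map_preimage[OF this op]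
  have op': "open {t. (\<lambda>i. t * f u i) \<in> F ` topspace ?E}"
    by simp
  have "F (\<lambda>_. 0) = (\<lambda>i. 0 * f u i)" "(\<lambda>_. 0) \<in> topspace ?E"
    by (auto simp: F_def r_def topspace_Euclidean_space)
  then have "0 \<in> {t. (\<lambda>i. t * f u i) \<in> F ` topspace ?E}"
    by (metis image_eqI mem_Collect_eq)
  then obtain e where e: "e > 0" "cball 0 e \<subseteq> {t. (\<lambda>i. t * f u i) \<in> F ` topspace ?E}"
    using op' open_contains_cball by blast
  then have "- e \<in> {t. (\<lambda>i. t * f u i) \<in> F ` topspace ?E}"
    by (intro subsetD[OF e(2)]) (use e(1) in simp)
  then obtain y where y: "y \<in> topspace ?E" "F y = (\<lambda>i. - e * f u i)"
    by fastforce
  obtain v t where v: "v \<in> ?S" "t \<ge> 0" "F y = (\<lambda>i. t * f v i)"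
    using polar[OF y(1)] by blast
  have rel: "e * f u j + t * f v j = 0" for j
    using fun_cong[OF y(2), of j] fun_cong[OF v(3), of j] by simp
  \<comment> \<open>Otherwise 2-regularity would force \<open>e = 0\<close>. With equal directions,
    \<open>nz\<close> then forces \<open>e + t = 0\<close>, although \<open>e > 0\<close> and
    \<open>t \<ge> 0\<close>.\<close>
  have "u = v"
  proof (rule ccontr)
    assume "u \<noteq> v"
    then show False
      using k_regular_map_2D(1)[OF f u v(1), of e t] rel e(1) by simp
  qed
  then have "(e + t) * f u j = 0" for j
    using rel[of j] by (simp add: algebra_simps)
  then have "e + t = 0"
    using nz[OF u] by blast
  then show False
    using e v by simp
qed

theorem corollary1p3:
  fixes m N :: nat
  assumes "m \<ge> 2"
  shows "((\<exists>f. k_regular_map 3 (nsphere m) N f) \<longleftrightarrow> (\<exists>f. k_regular_map 2 (nsphere m) N f))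
       \<and> ((\<exists>f. k_regular_map 2 (nsphere m) N f) \<longleftrightarrow> N \<ge> m + 2)"
proof -
  have "infinite (topspace (nsphere m))"
    using assms by (simp add: infinite_topspace_nsphere)
  then have "k_regular_map 2 (nsphere m) N f" if "k_regular_map 3 (nsphere m) N f" for f
    using that k_regular_map_antimono[of 3 "nsphere m" N f 2] by simp
  moreover have "\<exists>f. k_regular_map 3 (nsphere m) N f" if "N \<ge> m + 2"
    using k_regular_map_mono_codomain[OF k_regular_map_3_nsphere that] by blast
  ultimately show ?thesis
    using k_regular_map_2_nsphere_dim by blast
qed

end
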